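(* Let $k$ be a positive integer and let $n>k$ be an integer such that $n\in\{2k-1,2k+1\}$ or $n>2k^2$. Then $eqdim(J(n,k))\le n$.
   Context: For integers $n>k\ge 1$, the Johnson graph $J(n,k)$ has as vertices the $k$-element subsets of an $n$-element set, two vertices being adjacent if and only if their intersection has size $k-1$. $d(x,y)$ denotes the graph distance. A set $S\subseteq V(G)$ of vertices of a connected graph $G$ is a distance-equalizer set of $G$ if for every two distinct vertices $x,y\in V(G)\setminus S$ there is $w\in S$ with $d(x,w)=d(y,w)$. The equidistant dimension $eqdim(G)$ is the minimum cardinality of a distance-equalizer set of $G$. *)

theory Defs
  imports "Graph_Theory.Graph_Theory"
begin

definition johnson_graph :: "'a set \<Rightarrow> nat \<Rightarrow> 'a set pair_pre_digraph" where
  "johnson_graph X k =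
     \<lparr> pverts = {A. A \<subseteq> X \<and> card A = k},
       parcs = {(A, B). A \<subseteq> X \<and> card A = k \<and> B \<subseteq> X \<and> card B = k \<and>
                        card (A \<inter> B) = k - 1} \<rparr>"

lemma pair_graph_johnson_graph:
  assumes "finite X" and "0 < k"
  shows "pair_graph (johnson_graph X k)"
proof
  have fin: "finite (Pow X)" using assms(1) by simp
  show "finite (pverts (johnson_graph X k))"
    by (rule finite_subset[OF _ fin]) (auto simp: johnson_graph_def)
  show "finite (parcs (johnson_graph X k))"
    by (rule finite_subset[OF _ finite_cartesian_product[OF fin fin]])
       (auto simp: johnson_graph_def)
  show "symmetric (johnson_graph X k)"
    by (auto simp: symmetric_def johnson_graph_def sym_def Int_commute)
next
  fix e assume e: "e \<in> parcs (johnson_graph X k)"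
  then show "fst e \<in> pverts (johnson_graph X k)" "snd e \<in> pverts (johnson_graph X k)"
    by (auto simp: johnson_graph_def)
  show "fst e \<noteq> snd e"
  proof
    assume "fst e = snd e"
    with e have "card (fst e) = k" "card (fst e) = k - 1"
      by (auto simp: johnson_graph_def split_beta)
    with assms(2) show False by linarith
  qed
qed

text \<open>The length of a shortest walk, which is infinite if there is none.\<close>
definition graph_dist :: "('a, 'b) pre_digraph \<Rightarrow> 'a \<Rightarrow> 'a \<Rightarrow> ereal" where
  "graph_dist G x y = wf_digraph.\<mu> G (\<lambda>_. 1) x y"

definition distance_equalizer_set :: "('a, 'b) pre_digraph \<Rightarrow> 'a set \<Rightarrow> bool" where
  "distance_equalizer_set G S \<longleftrightarrow>
     S \<subseteq> verts G \<and>
     (\<forall>x \<in> verts G - S. \<forall>y \<in> verts G - S. x \<noteq> y \<longrightarrow>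
        (\<exists>w \<in> S. graph_dist G x w = graph_dist G y w))"

text \<open>Meaningful for finite graphs, where the vertex set itself is a distance-equalizer set.\<close>
definition eqdim :: "('a, 'b) pre_digraph \<Rightarrow> nat" where
  "eqdim G = (LEAST m. \<exists>S. distance_equalizer_set G S \<and> finite S \<and> card S = m)"

lemma distance_equalizer_set_verts: "distance_equalizer_set G (verts G)"
  by (simp add: distance_equalizer_set_def)

end

theory Submission
  imports Defs
begin

text \<open>
  The distance in \<open>J(n,k)\<close> between \<open>A\<close> and \<open>B\<close> is \<open>k - |A \<inter> B|\<close>, so a \<open>k\<close>-set \<open>W\<close> is equidistant from
  \<open>x\<close> and \<open>y\<close> iff \<open>|x \<inter> W| = |y \<inter> W|\<close>. Arrange the ground set on a cycle and take for the
  distance-equalizer set the arcs of \<open>k\<close> consecutive points; there are at most \<open>n\<close> of them. In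
  every case an arc equidistant from two given \<open>k\<close>-sets \<open>x\<close> and \<open>y\<close> exists.

  If \<open>n > 2 k\<^sup>2\<close>, each of the at most \<open>2 k\<close> points of \<open>x \<union> y\<close> lies on at most \<open>k\<close> arcs. Hence some
  arc misses both \<open>x\<close> and \<open>y\<close>.

  If \<open>n = 2 k \<plusminus> 1\<close>, let \<open>D i = |x \<inter> W\<^sub>i| - |y \<inter> W\<^sub>i|\<close> for the arc \<open>W\<^sub>i\<close> that starts at position
  \<open>i\<close>. The two consecutive arcs \<open>W\<^sub>i\<close> and \<open>W\<^bsub>i + k\<^esub>\<close> together run once round the cycle, up to one
  missing or one repeated point. As \<open>|x| = |y|\<close>, a full turn contributes nothing, so
  \<open>\<bar>D i + D (i + k)\<bar> \<le> 1\<close>. If \<open>D\<close> never vanished, \<open>D i\<close> and \<open>D (i + k)\<close> would always have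
  opposite signs. But \<open>n\<close> steps of length \<open>k\<close> lead back to the starting position, and \<open>n\<close> is
  odd, which would give \<open>D i\<close> and \<open>D i\<close> opposite signs.
\<close>

section \<open>Distances in Johnson graphs\<close>

text \<open>Adjacent vertices differ in a single exchanged element, so the intersection with a fixed set
  grows by at most one; this bounds the length of a walk from below.\<close>

lemma johnson_arc_card_Int_le:
  assumes "finite X" "0 < k" "(A, B) \<in> parcs (johnson_graph X k)"
  shows "card (B \<inter> W) \<le> Suc (card (A \<inter> W))"
proof -
  have B: "finite B" "card B = k" "card (A \<inter> B) = k - 1"
    using assms finite_subset[OF _ assms(1)] by (auto simp: johnson_graph_def)
  have "card (B - A) = card B - card (B \<inter> A)"
    using B by (simp add: card_Diff_subset_Int)
  then have one: "card (B - A) \<le> 1"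
    using B by (simp add: Int_commute)
  have finA: "finite A"
    using assms finite_subset[OF _ assms(1)] by (auto simp: johnson_graph_def)
  have "card (B \<inter> W) \<le> card ((A \<inter> W) \<union> (B - A))"
    using B finA by (intro card_mono) auto
  also have "\<dots> \<le> card (A \<inter> W) + card (B - A)"
    by (rule card_Un_le)
  finally show ?thesis
    using one by linarith
qed

lemma length_johnson_walk_ge:
  assumes "finite X" "0 < k" "pre_digraph.awalk (with_proj (johnson_graph X k)) A p B"
  shows "k \<le> card (A \<inter> B) + length p"
proof -
  interpret pair_graph "johnson_graph X k"
    using assms by (intro pair_graph_johnson_graph)
  show ?thesis
    using assms(3)
  proof (induction p arbitrary: A)
    case Nil
    then have "A = B" "A \<in> pverts (johnson_graph X k)"
      by (auto simp: awalk_Nil_iff)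
    then have "A = B" "card A = k"
      by (simp_all add: johnson_graph_def)
    then show ?case by simp
  next
    case (Cons e p)
    then obtain C where C: "e = (A, C)" "e \<in> parcs (johnson_graph X k)" "awalk C p B"
      by (cases e) (auto simp: awalk_Cons_iff)
    have "card (C \<inter> B) \<le> Suc (card (A \<inter> B))"
      using johnson_arc_card_Int_le[OF assms(1,2)] C by blast
    then show ?case
      using Cons.IH[OF C(3)] by simp
  qed
qed

text \<open>Exchanging a point of \<open>A - B\<close> for one of \<open>B - A\<close> moves one step closer to \<open>B\<close>.\<close>

lemma ex_johnson_walk:
  assumes "finite X" "0 < k" "A \<subseteq> X" "card A = k" "B \<subseteq> X" "card B = k"
  shows "\<exists>p. pre_digraph.awalk (with_proj (johnson_graph X k)) A p B \<and>
             length p = card (A - B)"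
proof -
  interpret pair_graph "johnson_graph X k"
    using assms by (intro pair_graph_johnson_graph)
  have finB: "finite B"
    using assms finite_subset by blast
  show ?thesis
    using assms(3,4)
  proof (induction "card (A - B)" arbitrary: A)
    case 0
    have "finite A"
      using 0 assms(1) finite_subset by blast
    then have "A = B"
      using 0 finB assms(6) by (metis card_0_eq card_subset_eq Diff_eq_empty_iff finite_Diff)
    moreover have "A \<in> pverts (johnson_graph X k)"
      using 0 by (simp add: johnson_graph_def)
    ultimately have "awalk A [] B"
      by (simp add: awalk_Nil_iff)
    then show ?case
      using 0 by (intro exI[of _ "[]"]) simp
  next
    case (Suc m)
    have finA: "finite A"
      using Suc assms(1) finite_subset by blast
    have "card (B - A) = card (A - B)"
      using finA finB Suc.prems assms(6) by (simp add: card_Diff_subset_Int Int_commute)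
    then obtain a b where ab: "a \<in> A" "a \<notin> B" "b \<in> B" "b \<notin> A"
      using Suc.hyps(2) by (metis DiffE card.empty equals0I nat.distinct(1))
    define C where "C = insert b (A - {a})"
    have C: "C \<subseteq> X" "card C = k"
      using ab Suc.prems assms(2,5) finA by (auto simp: C_def)
    have "C - B = (A - B) - {a}"
      using ab by (auto simp: C_def)
    then have "m = card (C - B)"
      using ab finA Suc.hyps(2) by simp
    from Suc.hyps(1)[OF this C] obtain p where p: "awalk C p B" "length p = card (C - B)"
      by blast
    have "A \<inter> C = A - {a}"
      using ab by (auto simp: C_def)
    then have "(A, C) \<in> parcs (johnson_graph X k)"
      using C Suc.prems ab finA by (simp add: johnson_graph_def)
    then have "awalk A ((A, C) # p) B"
      using p by (simp add: awalk_Cons_iff)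
    then show ?case
      using p \<open>m = card (C - B)\<close> Suc.hyps(2) by (intro exI[of _ "(A, C) # p"]) simp
  qed
qed

lemma graph_dist_johnson_graph:
  assumes "finite X" "0 < k" "A \<subseteq> X" "card A = k" "B \<subseteq> X" "card B = k"
  shows "graph_dist (with_proj (johnson_graph X k)) A B = ereal (real (k - card (A \<inter> B)))"
proof -
  interpret pair_graph "johnson_graph X k"
    using assms by (intro pair_graph_johnson_graph)
  have cost: "awalk_cost (\<lambda>_. 1) p = real (length p)" for p
    by (induction p) auto
  have "finite A"
    using assms finite_subset by blast
  then have "card (A - B) = k - card (A \<inter> B)"
    using assms by (simp add: card_Diff_subset_Int)
  then obtain p where p: "awalk A p B" "length p = k - card (A \<inter> B)"
    using ex_johnson_walk[OF assms] by auto
  show ?thesis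
    unfolding graph_dist_def
  proof (rule antisym)
    show "\<mu> (\<lambda>_. 1) A B \<le> ereal (real (k - card (A \<inter> B)))"
      using min_cost_le_walk_cost[OF p(1), of "\<lambda>_. 1"] p(2) by (simp add: cost)
    show "ereal (real (k - card (A \<inter> B))) \<le> \<mu> (\<lambda>_. 1) A B"
      unfolding \<mu>_def
    proof (rule INF_greatest)
      fix q assume "q \<in> {q. awalk A q B}"
      then have "k \<le> card (A \<inter> B) + length q"
        using length_johnson_walk_ge[OF assms(1,2)] by blast
      then show "ereal (real (k - card (A \<inter> B))) \<le> ereal (awalk_cost (\<lambda>_. 1) q)"
        by (simp add: cost)
    qed
  qed
qed

section \<open>Arcs of a cyclic arrangement\<close>

text \<open>A cyclic arrangement is unrolled to an enumeration by all natural numbers, so that arcs are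
  images of ordinary intervals and no index has to be reduced modulo the number of points.\<close>

definition cyclic_enumeration :: "'a set \<Rightarrow> (nat \<Rightarrow> 'a) \<Rightarrow> bool" where
  "cyclic_enumeration X h \<longleftrightarrow> (\<forall>i. bij_betw h {i..<i + card X} X)"

definition cyclic_arc :: "(nat \<Rightarrow> 'a) \<Rightarrow> nat \<Rightarrow> nat \<Rightarrow> 'a set" where
  "cyclic_arc h k i = h ` {i..<i + k}"

lemma ex_cyclic_enumeration:
  assumes "finite X"
  shows "\<exists>h. cyclic_enumeration X h"
proof -
  define n where "n = card X"
  obtain e where e: "bij_betw e {0..<n} X"
    using ex_bij_betw_nat_finite[OF assms] n_def by blast
  have "bij_betw (\<lambda>j. j mod n) {i..<i + n} {0..<n}" for i
  proof -
    have inj: "inj_on (\<lambda>j. j mod n) {i..<i + n}"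
    proof (rule linorder_inj_onI)
      fix a b assume *: "a < b" "a \<in> {i..<i + n}" "b \<in> {i..<i + n}"
      then have "b - a < n" "0 < b - a"
        by auto
      then have "\<not> n dvd b - a"
        using nat_dvd_not_less by blast
      then show "a mod n \<noteq> b mod n"
        using *(1) by (metis less_imp_le mod_eq_dvd_iff_nat)
    qed auto
    have "(\<lambda>j. j mod n) ` {i..<i + n} = {0..<n}"
      using card_image[OF inj] by (intro card_subset_eq) auto
    with inj show ?thesis
      by (simp add: bij_betw_def)
  qed
  then have "cyclic_enumeration X (e \<circ> (\<lambda>j. j mod n))"
    using e bij_betw_trans unfolding cyclic_enumeration_def n_def by blast
  then show ?thesis
    by blast
qed

lemma cyclic_arc_subset:
  assumes "cyclic_enumeration X h" "k \<le> card X"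
  shows "cyclic_arc h k i \<subseteq> X"
proof -
  have "{i..<i + k} \<subseteq> {i..<i + card X}"
    using assms(2) by auto
  then show ?thesis
    using assms(1) unfolding cyclic_arc_def cyclic_enumeration_def bij_betw_def by blast
qed

lemma card_Int_cyclic_arc:
  assumes "cyclic_enumeration X h" "k \<le> card X"
  shows "card (A \<inter> cyclic_arc h k i) = (\<Sum>j\<in>{i..<i + k}. of_bool (h j \<in> A))"
proof -
  have "inj_on h {i..<i + card X}"
    using assms(1) by (auto simp: cyclic_enumeration_def bij_betw_def)
  then have inj: "inj_on h {i..<i + k}"
    using assms(2) by (elim inj_on_subset) auto
  have "A \<inter> cyclic_arc h k i = h ` ({i..<i + k} \<inter> {j. h j \<in> A})"
    by (auto simp: cyclic_arc_def)
  also have "card \<dots> = card ({i..<i + k} \<inter> {j. h j \<in> A})"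
    using inj by (intro card_image inj_on_subset[OF inj]) auto
  finally show ?thesis
    by (simp add: sum_of_bool_eq)
qed

lemma card_cyclic_arc:
  assumes "cyclic_enumeration X h" "k \<le> card X"
  shows "card (cyclic_arc h k i) = k"
  using card_Int_cyclic_arc[OF assms, of UNIV i] by simp

text \<open>The arcs meeting \<open>A\<close> are few: every point of \<open>A\<close> lies on at most \<open>k\<close> arcs, since it is the
  \<open>j\<close>-th point of at most one of them for each \<open>j < k\<close>.\<close>

lemma ex_cyclic_arc_disjoint:
  assumes h: "cyclic_enumeration X h" and "finite A" "card A * k < card X"
  shows "\<exists>i<card X. A \<inter> cyclic_arc h k i = {}"
proof (rule ccontr)
  let ?P = "\<lambda>(a, j). {i. i < card X \<and> h (i + j) = a}"
  assume neg: "\<not> ?thesis"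
  have "{..<card X} \<subseteq> (\<Union>p\<in>A \<times> {..<k}. ?P p)"
  proof
    fix i assume i: "i \<in> {..<card X}"
    then obtain m where "m \<in> {i..<i + k}" "h m \<in> A"
      using neg by (fastforce simp: cyclic_arc_def)
    then show "i \<in> (\<Union>p\<in>A \<times> {..<k}. ?P p)"
      using i by (auto intro!: bexI[of _ "h m"] bexI[of _ "m - i"])
  qed
  then have "card X \<le> card (\<Union>p\<in>A \<times> {..<k}. ?P p)"
    using card_mono[of "\<Union>p\<in>A \<times> {..<k}. ?P p" "{..<card X}"] assms(2) by fastforce
  also have "\<dots> \<le> (\<Sum>p\<in>A \<times> {..<k}. card (?P p))"
    using assms(2) by (intro card_UN_le) auto
  also have "\<dots> \<le> (\<Sum>p\<in>A \<times> {..<k}. 1)"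
  proof (rule sum_mono)
    fix p assume "p \<in> A \<times> {..<k}"
    obtain a j where p: "p = (a, j)"
      by (cases p)
    have inj: "inj_on h {j..<j + card X}"
      using h by (auto simp: cyclic_enumeration_def bij_betw_def)
    have "i = i'" if "i \<in> ?P p" "i' \<in> ?P p" for i i'
      using that inj_onD[OF inj, of "i + j" "i' + j"] by (auto simp: p)
    moreover have "finite (?P p)"
      by (simp add: p)
    ultimately show "card (?P p) \<le> 1"
      unfolding One_nat_def by (simp only: card_le_Suc0_iff_eq) blast
  qed
  also have "\<dots> = card A * k"
    by (simp add: card_cartesian_product)
  finally show False
    using assms(3) by simp
qed

section \<open>Balanced windows on an odd cycle\<close>

lemma periodic_if_window_sums_zero:
  fixes g :: "nat \<Rightarrow> int"
  assumes "0 < n" "\<And>i. sum g {i..<i + n} = 0"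
  shows "g (i + n) = g i"
proof -
  have "sum g {i..<i + n} = g i + sum g {Suc i..<i + n}"
    using assms(1) by (intro sum.atLeast_Suc_lessThan) simp
  moreover have "sum g {Suc i..<Suc i + n} = sum g {Suc i..<i + n} + g (i + n)"
    using assms(1) by simp
  ultimately show ?thesis
    using assms(2)[of i] assms(2)[of "Suc i"] by simp
qed

text \<open>Two consecutive windows of length \<open>k\<close> cover a period up to one position, so their sums
  almost cancel. Without a vanishing window sum, the sign would alternate along the steps of
  length \<open>k\<close>, contradicting that an odd number \<open>n\<close> of such steps is a multiple of the period.\<close>

lemma ex_window_sum_zero:
  fixes g :: "nat \<Rightarrow> int"
  assumes n: "n + 1 = 2 * k \<or> n = 2 * k + 1"
    and zero: "\<And>i. sum g {i..<i + n} = 0"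
    and bound: "\<And>i. \<bar>g i\<bar> \<le> 1"
  shows "\<exists>i<n. sum g {i..<i + k} = 0"
proof (rule ccontr)
  have "odd n"
    using n by presburger
  then have "0 < n"
    by (rule odd_pos)
  define D where "D i = sum g {i..<i + k}" for i
  assume "\<not> ?thesis"
  then have nz: "D i \<noteq> 0" if "i < n" for i
    using that by (auto simp: D_def)
  have per: "D (i + n * m) = D i" for i m
  proof (induction m)
    case (Suc m)
    have "D (i + n) = D i" for i
    proof -
      have "D (i + n) = (\<Sum>j\<in>{i..<i + k}. g (j + n))"
        using sum.shift_bounds_nat_ivl[of g i n "i + k"] by (simp add: D_def ac_simps)
      then show ?thesis
        by (simp add: D_def periodic_if_window_sums_zero[OF \<open>0 < n\<close> zero])
    qed
    from this[of "i + n * m"] Suc show ?case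
      by (simp add: ac_simps)
  qed simp
  have nz': "D i \<noteq> 0" for i
    using per[of "i mod n" "i div n"] nz[of "i mod n"] \<open>0 < n\<close> by simp
  have near: "\<bar>D i + D (i + k)\<bar> \<le> 1" for i
  proof -
    have two: "D i + D (i + k) = sum g {i..<i + 2 * k}"
      unfolding D_def by (subst sum.atLeastLessThan_concat) (auto simp: mult_2 add.assoc)
    show ?thesis
    proof (cases "n + 1 = 2 * k")
      case True
      then have "{i..<i + 2 * k} = {i..<Suc (i + n)}"
        by auto
      then have "D i + D (i + k) = sum g {i..<i + n} + g (i + n)"
        using two by simp
      then show ?thesis
        using zero bound by simp
    next
      case False
      then have "{i..<i + n} = {i..<Suc (i + 2 * k)}"
        using n by auto
      then have "sum g {i..<i + n} = D i + D (i + k) + g (i + 2 * k)"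
        using two by simp
      then show ?thesis
        using zero[of i] bound[of "i + 2 * k"] by simp
    qed
  qed
  have alt: "0 < D (m * k) \<longleftrightarrow> (0 < D 0 \<longleftrightarrow> even m)" for m
  proof (induction m)
    case (Suc m)
    have "0 < D (m * k + k) \<longleftrightarrow> \<not> 0 < D (m * k)"
      using near[of "m * k"] nz'[of "m * k"] nz'[of "m * k + k"] by linarith
    with Suc show ?case
      by (auto simp: add.commute)
  qed simp
  show False
    using \<open>odd n\<close> alt[of n] per[of 0 k] by simp
qed

lemma ex_cyclic_arc_balanced:
  assumes h: "cyclic_enumeration X h"
    and n: "card X + 1 = 2 * k \<or> card X = 2 * k + 1"
    and A: "A \<subseteq> X" and B: "B \<subseteq> X" and eq: "card A = card B"
  shows "\<exists>i<card X. card (A \<inter> cyclic_arc h k i) = card (B \<inter> cyclic_arc h k i)"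
proof -
  define g :: "nat \<Rightarrow> int" where "g j = of_bool (h j \<in> A) - of_bool (h j \<in> B)" for j
  have g: "sum g {i..<i + l} =
      int (card (A \<inter> cyclic_arc h l i)) - int (card (B \<inter> cyclic_arc h l i))"
    if "l \<le> card X" for i l
    by (simp add: card_Int_cyclic_arc[OF h that] g_def sum_subtractf of_nat_sum)
  have full: "cyclic_arc h (card X) i = X" for i
    using h by (auto simp: cyclic_arc_def cyclic_enumeration_def bij_betw_def)
  have "sum g {i..<i + card X} = 0" for i
    using g[of "card X" i] A B eq by (simp add: full Int_absorb2)
  moreover have "\<bar>g i\<bar> \<le> 1" for i
    by (simp add: g_def)
  ultimately obtain i where "i < card X" "sum g {i..<i + k} = 0"
    using ex_window_sum_zero[OF n, of g] by blast
  moreover have "k \<le> card X"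
    using n by linarith
  ultimately show ?thesis
    using g[of k i] by auto
qed

section \<open>The bound on the equidistant dimension\<close>

theorem proposition16:
  fixes X :: "'a set" and n k :: nat
  assumes "finite X" and "card X = n"
    and "1 \<le> k" and "k < n"
    and "n \<in> {2 * k - 1, 2 * k + 1} \<or> n > 2 * k\<^sup>2"
  shows "eqdim (with_proj (johnson_graph X k)) \<le> n"
proof -
  let ?G = "with_proj (johnson_graph X k)"
  have kn: "k \<le> card X" and k0: "0 < k"
    using assms by auto
  obtain h where h: "cyclic_enumeration X h"
    using ex_cyclic_enumeration[OF assms(1)] by blast
  define S where "S = cyclic_arc h k ` {..<n}"
  have arc: "cyclic_arc h k i \<subseteq> X" "card (cyclic_arc h k i) = k" for i
    using cyclic_arc_subset[OF h kn] card_cyclic_arc[OF h kn] by auto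
  have equal: "\<exists>i<n. card (x \<inter> cyclic_arc h k i) = card (y \<inter> cyclic_arc h k i)"
    if x: "x \<subseteq> X" "card x = k" and y: "y \<subseteq> X" "card y = k" for x y
  proof (cases "n > 2 * k\<^sup>2")
    case True
    have "card (x \<union> y) * k \<le> (k + k) * k"
      using card_Un_le[of x y] x y by (intro mult_right_mono) auto
    also have "\<dots> < card X"
      using True assms(2) by (simp add: power2_eq_square algebra_simps)
    finally have "card (x \<union> y) * k < card X" .
    then obtain i where i: "i < n" "(x \<union> y) \<inter> cyclic_arc h k i = {}"
      using ex_cyclic_arc_disjoint[OF h, of "x \<union> y" k]
        finite_subset[OF _ assms(1)] x y assms(2) by auto
    then have "x \<inter> cyclic_arc h k i = {}" "y \<inter> cyclic_arc h k i = {}"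
      by auto
    with i show ?thesis
      by auto
  next
    case False
    then have "card X + 1 = 2 * k \<or> card X = 2 * k + 1"
      using assms by auto
    then show ?thesis
      using ex_cyclic_arc_balanced[OF h, of k x y] x y assms(2) by auto
  qed
  have "distance_equalizer_set ?G S"
    unfolding distance_equalizer_set_def
  proof (intro conjI ballI impI)
    show "S \<subseteq> verts ?G"
      using arc by (auto simp: S_def johnson_graph_def)
  next
    fix x y assume "x \<in> verts ?G - S" "y \<in> verts ?G - S"
    then have x: "x \<subseteq> X" "card x = k" and y: "y \<subseteq> X" "card y = k"
      by (auto simp: johnson_graph_def)
    obtain i where "i < n" "card (x \<inter> cyclic_arc h k i) = card (y \<inter> cyclic_arc h k i)"
      using equal[OF x y] by blast
    then have "cyclic_arc h k i \<in> S"
      and "graph_dist ?G x (cyclic_arc h k i) = graph_dist ?G y (cyclic_arc h k i)"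
      using x y by (simp_all add: S_def graph_dist_johnson_graph[OF assms(1) k0 _ _ arc])
    then show "\<exists>w\<in>S. graph_dist ?G x w = graph_dist ?G y w"
      by blast
  qed
  moreover have "finite S"
    by (simp add: S_def)
  ultimately have "eqdim ?G \<le> card S"
    unfolding eqdim_def by (blast intro: Least_le)
  also have "card S \<le> n"
    using card_image_le[of "{..<n}" "cyclic_arc h k"] by (simp add: S_def)
  finally show ?thesis .
qed

end
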